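(* For the Euclidean plane $\mathbb{R}^2$ and every $t>0$, $$\Omega_{\mathbb{R}^2}(t)=\frac12\cdot\left(\frac{\sqrt5-1}{2}\right)^{5/2}\cdot t\qquad(\approx 0.15\cdot t).$$
   Context: For a geodesic metric space $(X,d)$, a triangle $\Delta=\Delta(x,y,z)$ is the union of three geodesics $[x,y],[y,z],[z,x]$ (its sides; straight segments when $X=\mathbb{R}^2$), and its perimeter is $\mathrm{pr}(\Delta)=d(x,y)+d(y,z)+d(z,x)$. A triangle with sides $\ell_1,\ell_2,\ell_3$ satisfies the Rips condition with constant $\delta$ if, whenever $\{i,j,k\}=\{1,2,3\}$, every point of $\ell_i$ is at distance at most $\delta$ from $\ell_j\cup\ell_k$. Let $\delta(\Delta)=\inf\{\delta:\ \Delta \text{ satisfies the Rips condition with constant } \delta\}$ and $\Omega_X(t)=\sup\{\delta(\Delta):\ \Delta \text{ a triangle in } X \text{ with } \mathrm{pr}(\Delta)\le t\}$ for $t>0$. *)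

theory Defs
  imports "HOL-Analysis.Analysis"
begin

definition geodesic_from_to :: "'a::metric_space \<Rightarrow> 'a \<Rightarrow> 'a set \<Rightarrow> bool" where
  "geodesic_from_to x y S \<longleftrightarrow>
     (\<exists>g. g 0 = x \<and> g (dist x y) = y \<and>
          (\<forall>s\<in>{0..dist x y}. \<forall>t\<in>{0..dist x y}. dist (g s) (g t) = \<bar>s - t\<bar>) \<and>
          S = g ` {0..dist x y})"

text \<open>A triangle is given by its vertices together with a choice of sides
  \<open>l1 = [x,y]\<close>, \<open>l2 = [y,z]\<close>, \<open>l3 = [z,x]\<close>; the sides are part of the data because
  geodesics need not be unique. Degenerate triangles are allowed.\<close>

definition geodesic_triangle ::
    "'a::metric_space \<Rightarrow> 'a \<Rightarrow> 'a \<Rightarrow> 'a set \<Rightarrow> 'a set \<Rightarrow> 'a set \<Rightarrow> bool" where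
  "geodesic_triangle x y z l1 l2 l3 \<longleftrightarrow>
     geodesic_from_to x y l1 \<and> geodesic_from_to y z l2 \<and> geodesic_from_to z x l3"

definition triangle_perimeter :: "'a::metric_space \<Rightarrow> 'a \<Rightarrow> 'a \<Rightarrow> real" where
  "triangle_perimeter x y z = dist x y + dist y z + dist z x"

definition rips_condition :: "'a::metric_space set \<Rightarrow> 'a set \<Rightarrow> 'a set \<Rightarrow> real \<Rightarrow> bool" where
  "rips_condition l1 l2 l3 \<delta> \<longleftrightarrow>
     (\<forall>p\<in>l1. infdist p (l2 \<union> l3) \<le> \<delta>) \<and>
     (\<forall>p\<in>l2. infdist p (l1 \<union> l3) \<le> \<delta>) \<and>
     (\<forall>p\<in>l3. infdist p (l1 \<union> l2) \<le> \<delta>)"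

text \<open>Infimum and supremum are taken in the extended reals, so that an equation with a
  finite value also asserts that the supremum is finite (on \<^typ>\<open>real\<close> the supremum of an
  unbounded set is an unspecified number).\<close>

definition triangle_delta :: "'a::metric_space set \<Rightarrow> 'a set \<Rightarrow> 'a set \<Rightarrow> ereal" where
  "triangle_delta l1 l2 l3 = (INF \<delta>\<in>{\<delta>. rips_condition l1 l2 l3 \<delta>}. ereal \<delta>)"

text \<open>The first argument only selects the space: the whole type \<open>'a\<close>.\<close>

definition rips_Omega :: "'a::metric_space itself \<Rightarrow> real \<Rightarrow> ereal" where
  "rips_Omega _ t =
     Sup {triangle_delta l1 l2 l3 | (x::'a) y z l1 l2 l3.
            geodesic_triangle x y z l1 l2 l3 \<and> triangle_perimeter x y z \<le> t}"

end

theory Submission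
  imports Defs
begin

text \<open>
  Let \<open>c = (sqrt 5 - 1) / 2\<close>, so that \<open>c\<^sup>2 = 1 - c\<close>. In Euclidean space geodesics are straight
  segments, so one has to show that a point \<open>p\<close> of the side \<open>[x,y]\<close> of a triangle of perimeter
  \<open>P\<close> has distance \<open>D \<le> c powr (5/2) / 2 * P\<close> from the union of the other two sides, and that
  equality occurs.

  Upper bound. Choose coordinates with \<open>p = (0,0)\<close>, \<open>x = (-a,0)\<close>, \<open>y = (b,0)\<close>, \<open>z = (u,v)\<close>.
  Suppose first that the feet of the perpendiculars from \<open>p\<close> to the lines \<open>xz\<close> and \<open>yz\<close> lie on
  the sides. Computing the areas of \<open>pxz\<close> and \<open>pyz\<close> in two ways then gives
  \<open>D * |xz| \<le> a * v\<close> and \<open>D * |yz| \<le> b * v\<close>. With \<open>2 * s = a + b\<close> and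
  \<open>2 * L = |xz| + |yz|\<close> this yields \<open>D * L \<le> s * v\<close>, while \<open>s\<^sup>2 + v\<^sup>2 \<le> L\<^sup>2\<close> by the triangle
  inequality. So \<open>D\<^sup>2 * L\<^sup>2 \<le> s\<^sup>2 * (L\<^sup>2 - s\<^sup>2)\<close>, and the identity
  \<open>c^5 * L\<^sup>2 * (L + s) - s\<^sup>2 * (L - s) = (s - c * L)\<^sup>2 * (s + c^3 * L)\<close>
  gives \<open>D\<^sup>2 \<le> c^5 * (s + L)\<^sup>2\<close> (\<open>golden_inequality\<close>), which is the claim since
  \<open>P = 2 * (s + L)\<close>. The lemmas refer to \<open>c powr (5/2)\<close> as the nonnegative number \<open>K\<close> with
  \<open>K\<^sup>2 = c^5\<close>.

  If a foot lies outside its side, the triangle can be shrunk to one of smaller perimeter in which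
  it does not, with \<open>p\<close> still at distance at least \<open>D\<close>. An obtuse angle at \<open>x\<close> is made right by
  moving \<open>z\<close> along \<open>[z,y]\<close> (\<open>dist_bound_obtuse_base\<close>), an obtuse angle \<open>pzx\<close> by moving \<open>x\<close>
  along \<open>[x,p]\<close> (\<open>shrink_to_foot_on_side\<close>).

  Equality. Take the isosceles triangle with \<open>s = c * L\<close>, that is, with base angles of cosine
  \<open>c\<close>, and the midpoint of its base (\<open>isosceles_midpoint_dist\<close>).
\<close>

section \<open>The extremal inequality\<close>

lemma golden_square: "((sqrt 5 - 1) / 2)\<^sup>2 = 1 - (sqrt 5 - 1) / (2::real)"
  by (simp add: power2_eq_square field_simps)

lemma golden_pos: "0 < (sqrt 5 - 1) / (2::real)"
  by simp

lemma golden_powr: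
  "(((sqrt 5 - 1) / 2) powr (5 / 2))\<^sup>2 = ((sqrt 5 - 1) / (2::real)) ^ 5"
proof -
  have "(((sqrt 5 - 1) / 2) powr (5 / 2))\<^sup>2 = ((sqrt 5 - 1) / (2::real)) powr (5/2 + 5/2)"
    by (simp only: powr_add power2_eq_square)
  also have "\<dots> = ((sqrt 5 - 1) / (2::real)) ^ 5"
    using powr_realpow[OF golden_pos, of 5] by simp
  finally show ?thesis .
qed

lemma golden_inequality:
  fixes s v L D c :: real
  assumes c: "c\<^sup>2 = 1 - c" "0 < c"
    and s: "0 < s" and L: "0 < L" and D: "0 \<le> D"
    and pyth: "s\<^sup>2 + v\<^sup>2 \<le> L\<^sup>2" and area: "D * L \<le> s * v"
  shows "D\<^sup>2 \<le> c ^ 5 * (s + L)\<^sup>2"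
proof -
  have "(D * L)\<^sup>2 \<le> (s * v)\<^sup>2"
    by (rule power_mono[OF area]) (use D L in simp)
  also have "\<dots> = s\<^sup>2 * v\<^sup>2" by (simp add: power_mult_distrib)
  also have "\<dots> \<le> s\<^sup>2 * (L\<^sup>2 - s\<^sup>2)"
    using pyth by (intro mult_left_mono) auto
  also have "\<dots> = s\<^sup>2 * (L - s) * (L + s)"
    by (simp add: power2_eq_square algebra_simps)
  also have "\<dots> \<le> c ^ 5 * L\<^sup>2 * (L + s) * (L + s)"
  proof (rule mult_right_mono)
    have "c ^ 5 * L\<^sup>2 * (L + s) - s\<^sup>2 * (L - s) = (s - c * L)\<^sup>2 * (s + c ^ 3 * L)"
      using c(1) by algebra
    also have "\<dots> \<ge> 0" using c s L by simp
    finally show "s\<^sup>2 * (L - s) \<le> c ^ 5 * L\<^sup>2 * (L + s)" by simp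
  qed (use s L in simp)
  finally have "D\<^sup>2 * L\<^sup>2 \<le> (c ^ 5 * (s + L)\<^sup>2) * L\<^sup>2"
    by (simp add: power2_eq_square algebra_simps)
  then show ?thesis using L by simp
qed

section \<open>Reduction to feet lying on the sides\<close>

text \<open>Here and below the segment from \<open>(-a,0)\<close> to \<open>(u,v)\<close> is parametrised by \<open>t\<close>, and the
  hypothesis \<open>dist\<close> says that its points have distance at least \<open>D\<close> from the origin. The number
  \<open>a'\<close> is \<open>a\<close> unless the angle at \<open>(u,v)\<close> between the segment and the direction of the origin is
  obtuse, when \<open>(-a',0)\<close> is the point for which this angle is right.\<close>

lemma shrink_to_foot_on_side:
  fixes a u v D :: real
  assumes a: "0 < a" and u: "- a \<le> u" and v: "0 \<le> v" and D: "0 < D"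
    and dist: "\<And>t. 0 \<le> t \<Longrightarrow> t \<le> 1 \<Longrightarrow> D\<^sup>2 \<le> (t * u - (1 - t) * a)\<^sup>2 + (t * v)\<^sup>2"
  shows "\<exists>a'. 0 < a' \<and> a' \<le> a \<and> D * sqrt ((a' + u)\<^sup>2 + v\<^sup>2) \<le> a' * v \<and>
              sqrt ((a' + u)\<^sup>2 + v\<^sup>2) \<le> sqrt ((a + u)\<^sup>2 + v\<^sup>2)"
proof (cases "a * (a + u) \<le> (a + u)\<^sup>2 + v\<^sup>2")
  case True
  define M where "M = (a + u)\<^sup>2 + v\<^sup>2"
  have "D\<^sup>2 * M \<le> (a * v)\<^sup>2"
  proof (cases "M = 0")
    case False
    then have M: "0 < M" by (simp add: M_def sum_power2_gt_zero_iff)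
    \<comment> \<open>the parameter of the foot of the perpendicular from the origin\<close>
    define t where "t = a * (a + u) / M"
    have t: "0 \<le> t" "t \<le> 1" and tM: "t * M = a * (a + u)"
      using a u True M by (auto simp: t_def M_def[symmetric])
    have "D\<^sup>2 * M \<le> ((t * u - (1 - t) * a)\<^sup>2 + (t * v)\<^sup>2) * M"
      using dist[OF t] M by simp
    also have "\<dots> = (t * M)\<^sup>2 - 2 * (t * M) * (a * (a + u)) + a\<^sup>2 * M"
      by (simp add: M_def power2_eq_square algebra_simps)
    also have "\<dots> = (a * v)\<^sup>2"
      unfolding tM by (simp add: M_def power2_eq_square algebra_simps)
    finally show ?thesis .
  qed simp
  then have "sqrt (D\<^sup>2 * M) \<le> sqrt ((a * v)\<^sup>2)" by (rule real_sqrt_le_mono)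
  then have "D * sqrt M \<le> a * v" using D a v by (simp add: real_sqrt_mult)
  then show ?thesis using a unfolding M_def by blast
next
  case False
  then have neg: "u * (a + u) + v\<^sup>2 < 0" by (simp add: power2_eq_square algebra_simps)
  have "u * (a + u) < 0" using neg zero_le_power2[of v] by linarith
  then have u0: "u < 0" using u by (auto simp: mult_less_0_iff)
  define a' where "a' = (u\<^sup>2 + v\<^sup>2) / (- u)"
  have "0 < u\<^sup>2" using u0 by simp
  then have "0 < u\<^sup>2 + v\<^sup>2" using zero_le_power2[of v] by linarith
  then have pos: "0 < a'" using u0 unfolding a'_def by (intro divide_pos_pos) auto
  have le: "a' \<le> a"
    using u0 neg by (simp add: a'_def field_simps power2_eq_square)
  have au: "a' + u = v\<^sup>2 / (- u)" using u0 by (simp add: a'_def field_simps power2_eq_square)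
  then have au0: "0 \<le> a' + u" using u0 by (simp add: divide_nonneg_neg)
  have "D\<^sup>2 * ((a' + u)\<^sup>2 + v\<^sup>2) \<le> (u\<^sup>2 + v\<^sup>2) * ((a' + u)\<^sup>2 + v\<^sup>2)"
    using dist[of 1] by (intro mult_right_mono) auto
  also have "\<dots> = (a' * v)\<^sup>2"
    unfolding au unfolding a'_def using u0 by (simp add: field_simps power2_eq_square)
  finally have "sqrt (D\<^sup>2 * ((a' + u)\<^sup>2 + v\<^sup>2)) \<le> sqrt ((a' * v)\<^sup>2)" by (rule real_sqrt_le_mono)
  then have "D * sqrt ((a' + u)\<^sup>2 + v\<^sup>2) \<le> a' * v"
    using D pos v by (simp add: real_sqrt_mult)
  moreover have "sqrt ((a' + u)\<^sup>2 + v\<^sup>2) \<le> sqrt ((a + u)\<^sup>2 + v\<^sup>2)"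
    using au0 le by (intro real_sqrt_le_mono add_right_mono power_mono) auto
  ultimately show ?thesis using pos le by blast
qed

lemma dist_bound_acute_base:
  fixes a b u v D c K :: real
  assumes c: "c\<^sup>2 = 1 - c" "0 < c" and K: "K\<^sup>2 = c ^ 5" "0 \<le> K"
    and ab: "0 < a" "0 < b" and u: "- a \<le> u" "u \<le> b" and v: "0 \<le> v" and D: "0 < D"
    and dist1: "\<And>t. 0 \<le> t \<Longrightarrow> t \<le> 1 \<Longrightarrow> D\<^sup>2 \<le> (t * u - (1 - t) * a)\<^sup>2 + (t * v)\<^sup>2"
    and dist2: "\<And>t. 0 \<le> t \<Longrightarrow> t \<le> 1 \<Longrightarrow> D\<^sup>2 \<le> (t * u + (1 - t) * b)\<^sup>2 + (t * v)\<^sup>2"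
  shows "D \<le> K / 2 * (a + b + sqrt ((a + u)\<^sup>2 + v\<^sup>2) + sqrt ((b - u)\<^sup>2 + v\<^sup>2))"
proof -
  obtain a' where a': "0 < a'" "a' \<le> a" "D * sqrt ((a' + u)\<^sup>2 + v\<^sup>2) \<le> a' * v"
    "sqrt ((a' + u)\<^sup>2 + v\<^sup>2) \<le> sqrt ((a + u)\<^sup>2 + v\<^sup>2)"
    using shrink_to_foot_on_side[OF ab(1) u(1) v D dist1] by blast
  have "D\<^sup>2 \<le> (t * (- u) - (1 - t) * b)\<^sup>2 + (t * v)\<^sup>2" if "0 \<le> t" "t \<le> 1" for t
  proof -
    have "(t * (- u) - (1 - t) * b)\<^sup>2 = (t * u + (1 - t) * b)\<^sup>2"
      by (simp add: power2_eq_square algebra_simps)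
    then show ?thesis using dist2[OF that] by simp
  qed
  from shrink_to_foot_on_side[OF ab(2) _ v D this] u(2)
  obtain b' where b': "0 < b'" "b' \<le> b" "D * sqrt ((b' - u)\<^sup>2 + v\<^sup>2) \<le> b' * v"
    "sqrt ((b' - u)\<^sup>2 + v\<^sup>2) \<le> sqrt ((b - u)\<^sup>2 + v\<^sup>2)"
    by auto
  define L1 where "L1 = sqrt ((a' + u)\<^sup>2 + v\<^sup>2)"
  define L2 where "L2 = sqrt ((b' - u)\<^sup>2 + v\<^sup>2)"
  have "sqrt ((a' + b')\<^sup>2 + (2 * v)\<^sup>2) \<le> L1 + L2"
    using real_sqrt_sum_squares_triangle_ineq[of "a' + u" "b' - u" v v]
    by (simp add: L1_def L2_def)
  then have "(a' + b')\<^sup>2 + (2 * v)\<^sup>2 \<le> (L1 + L2)\<^sup>2"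
    by (rule sqrt_le_D)
  then have pyth: "((a' + b') / 2)\<^sup>2 + v\<^sup>2 \<le> ((L1 + L2) / 2)\<^sup>2"
    by (simp add: power_divide power_mult_distrib field_simps)
  have area: "D * ((L1 + L2) / 2) \<le> (a' + b') / 2 * v"
    using a'(3)[folded L1_def] b'(3)[folded L2_def] by (simp add: field_simps)
  have s: "0 < (a' + b') / 2" using a' b' by simp
  have "0 \<le> L1" "0 \<le> L2" by (auto simp: L1_def L2_def)
  moreover have "L1 + L2 \<noteq> 0"
  proof
    assume "L1 + L2 = 0"
    then have "((L1 + L2) / 2)\<^sup>2 = 0" by simp
    moreover have "0 < ((a' + b') / 2)\<^sup>2" using s by (rule zero_less_power)
    ultimately show False using pyth zero_le_power2[of v] by linarith
  qed
  ultimately have L: "0 < (L1 + L2) / 2" by simp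
  have "D\<^sup>2 \<le> c ^ 5 * ((a' + b') / 2 + (L1 + L2) / 2)\<^sup>2"
    using golden_inequality[OF c s L _ pyth area] D by simp
  also have "\<dots> = (K * ((a' + b') / 2 + (L1 + L2) / 2))\<^sup>2"
    using K(1) by (simp only: power_mult_distrib)
  finally have "D \<le> K * ((a' + b') / 2 + (L1 + L2) / 2)"
    by (rule power2_le_imp_le) (use K s L in simp)
  also have "\<dots> = K / 2 * (a' + b' + L1 + L2)" by (simp add: field_simps)
  also have "\<dots> \<le> K / 2 * (a + b + sqrt ((a + u)\<^sup>2 + v\<^sup>2) + sqrt ((b - u)\<^sup>2 + v\<^sup>2))"
    using a'(2) b'(2) a'(4)[folded L1_def] b'(4)[folded L2_def] K(2)
    by (intro mult_left_mono add_mono) simp_all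
  finally show ?thesis .
qed

text \<open>An obtuse angle at \<open>(-a,0)\<close> becomes right when \<open>(u,v)\<close> is replaced by the point
  \<open>(-a, r * v)\<close> of the segment from \<open>(b,0)\<close> to \<open>(u,v)\<close>.\<close>

lemma dist_bound_obtuse_base:
  fixes a b u v D c K :: real
  assumes c: "c\<^sup>2 = 1 - c" "0 < c" and K: "K\<^sup>2 = c ^ 5" "0 \<le> K"
    and ab: "0 < a" "0 < b" and u: "u < - a" and v: "0 \<le> v" and D: "0 < D"
    and dist1: "\<And>t. 0 \<le> t \<Longrightarrow> t \<le> 1 \<Longrightarrow> D\<^sup>2 \<le> (t * u - (1 - t) * a)\<^sup>2 + (t * v)\<^sup>2"
    and dist2: "\<And>t. 0 \<le> t \<Longrightarrow> t \<le> 1 \<Longrightarrow> D\<^sup>2 \<le> (t * u + (1 - t) * b)\<^sup>2 + (t * v)\<^sup>2"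
  shows "D \<le> K / 2 * (a + b + sqrt ((a + u)\<^sup>2 + v\<^sup>2) + sqrt ((b - u)\<^sup>2 + v\<^sup>2))"
proof -
  define r where "r = (a + b) / (b - u)"
  have r: "0 < r" "r \<le> 1" and ru: "r * (b - u) = a + b"
    using ab u by (auto simp: r_def)
  have 1: "D\<^sup>2 \<le> (t * (- a) - (1 - t) * a)\<^sup>2 + (t * (r * v))\<^sup>2" for t
  proof -
    have "t * (- a) - (1 - t) * a = - a" by (simp add: algebra_simps)
    moreover have "D\<^sup>2 \<le> a\<^sup>2" using dist1[of 0] by simp
    ultimately show ?thesis by (simp add: add_increasing2)
  qed
  have 2: "D\<^sup>2 \<le> (t * (- a) + (1 - t) * b)\<^sup>2 + (t * (r * v))\<^sup>2" if "0 \<le> t" "t \<le> 1" for t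
  proof -
    have "0 \<le> t * r" "t * r \<le> 1" using that r by (auto intro: mult_le_one)
    moreover have "t * r * u + (1 - t * r) * b = t * (- a) + (1 - t) * b"
      using ru by algebra
    ultimately show ?thesis using dist2[of "t * r"] by (simp add: mult.assoc)
  qed
  have "r * v \<le> v" using r v by (simp add: mult_left_le_one_le)
  have "D \<le> K / 2 * (a + b + sqrt ((a + - a)\<^sup>2 + (r * v)\<^sup>2) + sqrt ((b - - a)\<^sup>2 + (r * v)\<^sup>2))"
    using dist_bound_acute_base[OF c K ab _ _ _ D 1 2] ab v r by simp
  also have "sqrt ((a + - a)\<^sup>2 + (r * v)\<^sup>2) = r * v" using r v by simp
  also have "sqrt ((b - - a)\<^sup>2 + (r * v)\<^sup>2) = r * sqrt ((b - u)\<^sup>2 + v\<^sup>2)"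
  proof -
    have "(b - - a)\<^sup>2 + (r * v)\<^sup>2 = r\<^sup>2 * ((b - u)\<^sup>2 + v\<^sup>2)"
      using ru by algebra
    then show ?thesis using r by (simp add: real_sqrt_mult)
  qed
  also have "K / 2 * (a + b + r * v + r * sqrt ((b - u)\<^sup>2 + v\<^sup>2))
      \<le> K / 2 * (a + b + sqrt ((a + u)\<^sup>2 + v\<^sup>2) + sqrt ((b - u)\<^sup>2 + v\<^sup>2))"
  proof (intro mult_left_mono add_mono order_refl)
    show "r * v \<le> sqrt ((a + u)\<^sup>2 + v\<^sup>2)"
      by (rule order_trans[OF \<open>r * v \<le> v\<close>], rule real_le_rsqrt) simp
    show "r * sqrt ((b - u)\<^sup>2 + v\<^sup>2) \<le> sqrt ((b - u)\<^sup>2 + v\<^sup>2)"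
      using r by (simp add: mult_left_le_one_le)
  qed (use K in simp)
  finally show ?thesis .
qed

lemma dist_bound_coordinates:
  fixes a b u v D c K :: real
  assumes c: "c\<^sup>2 = 1 - c" "0 < c" and K: "K\<^sup>2 = c ^ 5" "0 \<le> K"
    and ab: "0 < a" "0 < b" and v: "0 \<le> v" and D: "0 < D"
    and dist1: "\<And>t. 0 \<le> t \<Longrightarrow> t \<le> 1 \<Longrightarrow> D\<^sup>2 \<le> (t * u - (1 - t) * a)\<^sup>2 + (t * v)\<^sup>2"
    and dist2: "\<And>t. 0 \<le> t \<Longrightarrow> t \<le> 1 \<Longrightarrow> D\<^sup>2 \<le> (t * u + (1 - t) * b)\<^sup>2 + (t * v)\<^sup>2"
  shows "D \<le> K / 2 * (a + b + sqrt ((a + u)\<^sup>2 + v\<^sup>2) + sqrt ((b - u)\<^sup>2 + v\<^sup>2))"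
proof -
  consider "u < - a" | "- a \<le> u" "u \<le> b" | "b < u" by linarith
  then show ?thesis
  proof cases
    case 1
    show ?thesis by (rule dist_bound_obtuse_base[OF c K ab 1 v D dist1 dist2])
  next
    case 2
    show ?thesis by (rule dist_bound_acute_base[OF c K ab 2 v D dist1 dist2])
  next
    case 3
    \<comment> \<open>the reflection \<open>u \<mapsto> - u\<close> exchanges the roles of \<open>a\<close> and \<open>b\<close>\<close>
    have 1: "D\<^sup>2 \<le> (t * (- u) - (1 - t) * b)\<^sup>2 + (t * v)\<^sup>2" if "0 \<le> t" "t \<le> 1" for t
      using dist2[OF that] by (simp add: power2_eq_square algebra_simps)
    have 2: "D\<^sup>2 \<le> (t * (- u) + (1 - t) * a)\<^sup>2 + (t * v)\<^sup>2" if "0 \<le> t" "t \<le> 1" for t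
      using dist1[OF that] by (simp add: power2_eq_square algebra_simps)
    show ?thesis
      using dist_bound_obtuse_base[OF c K ab(2,1) _ v D 1 2] 3 by (simp add: add_ac)
  qed
qed

section \<open>Triangles in Euclidean space\<close>

lemma norm_orthogonal_sum:
  fixes e w :: "'a::real_inner"
  assumes "norm e = 1" "e \<bullet> w = 0"
  shows "(norm (\<alpha> *\<^sub>R e + w))\<^sup>2 = \<alpha>\<^sup>2 + (norm w)\<^sup>2"
  using assms norm_add_Pythagorean[of "\<alpha> *\<^sub>R e" w] by (simp add: orthogonal_def)

lemma infdist_side_le:
  fixes x y z p :: "'a::euclidean_space"
  assumes c: "c\<^sup>2 = 1 - c" "0 < c" and K: "K\<^sup>2 = c ^ 5" "0 \<le> K"
    and p: "p \<in> closed_segment x y"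
  shows "infdist p (closed_segment y z \<union> closed_segment z x)
           \<le> K / 2 * (dist x y + dist y z + dist z x)"
proof (cases "infdist p (closed_segment y z \<union> closed_segment z x) > 0")
  case False
  moreover have "0 \<le> K / 2 * (dist x y + dist y z + dist z x)" using K by simp
  ultimately show ?thesis by linarith
next
  case True
  define D where "D = infdist p (closed_segment y z \<union> closed_segment z x)"
  have D: "0 < D" using True by (simp add: D_def)
  have le: "D \<le> dist p q" if "q \<in> closed_segment y z \<union> closed_segment z x" for q
    unfolding D_def using that by (rule infdist_le)
  have px: "p \<noteq> x" and py: "p \<noteq> y" using le[of x] le[of y] D by auto
  obtain r where r: "0 \<le> r" "r \<le> 1" and pr: "p = (1 - r) *\<^sub>R x + r *\<^sub>R y"
    using p by (auto simp: in_segment)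
  have xy: "x \<noteq> y" using p px by auto
  define n where "n = dist x y"
  have n: "0 < n" using xy by (simp add: n_def)
  define e where "e = (1 / n) *\<^sub>R (y - x)"
  have ne: "n *\<^sub>R e = y - x" and e1: "norm e = 1"
    using n by (auto simp: e_def n_def dist_norm norm_minus_commute)
  define a where "a = r * n"
  define b where "b = (1 - r) * n"
  have xe: "x = p - a *\<^sub>R e"
    by (simp add: a_def ne pr flip: scaleR_scaleR) (simp add: algebra_simps)
  have ye: "y = p + b *\<^sub>R e"
    by (simp add: b_def ne pr flip: scaleR_scaleR) (simp add: algebra_simps)
  have "a \<noteq> 0" "b \<noteq> 0" using px py xe ye by auto
  then have ab: "0 < a" "0 < b" using r n by (auto simp: a_def b_def less_le)
  have abn: "a + b = dist x y" by (simp add: a_def b_def n_def algebra_simps)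
  \<comment> \<open>In the plane of the triangle, with origin \<open>p\<close> and first axis along \<open>e\<close>, the vertex \<open>z\<close>
    has coordinates \<open>u\<close> and \<open>norm w\<close>.\<close>
  define u where "u = e \<bullet> (z - p)"
  define w where "w = z - p - u *\<^sub>R e"
  have "e \<bullet> e = 1" using e1 by (simp add: dot_square_norm)
  then have ew: "e \<bullet> w = 0" by (simp add: w_def u_def inner_diff_right)
  have ze: "z = p + u *\<^sub>R e + w" by (simp add: w_def)
  note pyth = norm_orthogonal_sum[OF e1]
  have zx: "dist z x = sqrt ((a + u)\<^sup>2 + (norm w)\<^sup>2)"
  proof -
    have "z - x = (a + u) *\<^sub>R e + w" unfolding xe ze by (simp add: algebra_simps)
    then have "(dist z x)\<^sup>2 = (a + u)\<^sup>2 + (norm w)\<^sup>2" by (simp only: dist_norm pyth[OF ew])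
    then show ?thesis by (metis real_sqrt_unique zero_le_dist)
  qed
  have yz: "dist y z = sqrt ((b - u)\<^sup>2 + (norm w)\<^sup>2)"
  proof -
    have "z - y = (u - b) *\<^sub>R e + w" unfolding ye ze by (simp add: algebra_simps)
    then have "(dist z y)\<^sup>2 = (u - b)\<^sup>2 + (norm w)\<^sup>2" by (simp only: dist_norm pyth[OF ew])
    then have "(dist y z)\<^sup>2 = (b - u)\<^sup>2 + (norm w)\<^sup>2" by (simp add: dist_commute power2_commute)
    then show ?thesis by (metis real_sqrt_unique zero_le_dist)
  qed
  have 1: "D\<^sup>2 \<le> (t * u - (1 - t) * a)\<^sup>2 + (t * norm w)\<^sup>2" if "0 \<le> t" "t \<le> 1" for t
  proof -
    define q where "q = (1 - t) *\<^sub>R x + t *\<^sub>R z"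
    have "q \<in> closed_segment x z" using that by (auto simp: q_def in_segment)
    then have "D \<le> dist p q" by (intro le) (simp add: closed_segment_commute)
    then have "D\<^sup>2 \<le> (dist q p)\<^sup>2" using D by (simp add: power_mono dist_commute)
    moreover have "q - p = (t * u - (1 - t) * a) *\<^sub>R e + t *\<^sub>R w"
      unfolding q_def xe ze by (simp add: algebra_simps)
    then have "(dist q p)\<^sup>2 = (t * u - (1 - t) * a)\<^sup>2 + (norm (t *\<^sub>R w))\<^sup>2"
      using ew by (simp only: dist_norm) (rule pyth, simp)
    ultimately show ?thesis by (simp add: power_mult_distrib)
  qed
  have 2: "D\<^sup>2 \<le> (t * u + (1 - t) * b)\<^sup>2 + (t * norm w)\<^sup>2" if "0 \<le> t" "t \<le> 1" for t
  proof -
    define q where "q = (1 - t) *\<^sub>R y + t *\<^sub>R z"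
    have "q \<in> closed_segment y z" using that by (auto simp: q_def in_segment)
    then have "D \<le> dist p q" by (intro le) simp
    then have "D\<^sup>2 \<le> (dist q p)\<^sup>2" using D by (simp add: power_mono dist_commute)
    moreover have "q - p = (t * u + (1 - t) * b) *\<^sub>R e + t *\<^sub>R w"
      unfolding q_def ye ze by (simp add: algebra_simps)
    then have "(dist q p)\<^sup>2 = (t * u + (1 - t) * b)\<^sup>2 + (norm (t *\<^sub>R w))\<^sup>2"
      using ew by (simp only: dist_norm) (rule pyth, simp)
    ultimately show ?thesis by (simp add: power_mult_distrib)
  qed
  have "D \<le> K / 2 * (a + b + sqrt ((a + u)\<^sup>2 + (norm w)\<^sup>2) + sqrt ((b - u)\<^sup>2 + (norm w)\<^sup>2))"
    using dist_bound_coordinates[OF c K ab _ D 1 2] by simp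
  then show ?thesis unfolding D_def[symmetric] abn zx[symmetric] yz[symmetric]
    by (simp add: add_ac)
qed

lemma geodesic_from_to_iff_closed_segment:
  fixes x y :: "'a::euclidean_space"
  shows "geodesic_from_to x y S \<longleftrightarrow> S = closed_segment x y"
proof
  assume "geodesic_from_to x y S"
  then obtain g where g0: "g 0 = x" and gd: "g (dist x y) = y"
    and iso: "\<And>s t. s \<in> {0..dist x y} \<Longrightarrow> t \<in> {0..dist x y} \<Longrightarrow> dist (g s) (g t) = \<bar>s - t\<bar>"
    and S: "S = g ` {0..dist x y}"
    unfolding geodesic_from_to_def by blast
  have gx: "dist x (g s) = s" and gy: "dist (g s) y = dist x y - s"
    if "s \<in> {0..dist x y}" for s
    using iso[of 0 s] iso[of s "dist x y"] that g0 gd by auto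
  have seg: "g s \<in> closed_segment x y" if "s \<in> {0..dist x y}" for s
    using gx[OF that] gy[OF that]
    by (simp add: between_mem_segment[symmetric] between)
  \<comment> \<open>a point of a segment is determined by its distance from one end\<close>
  have unique: "q = q'"
    if "q \<in> closed_segment x y" "q' \<in> closed_segment x y" "dist x q = dist x q'" for q q'
  proof -
    obtain r where r: "0 \<le> r" "q = (1 - r) *\<^sub>R x + r *\<^sub>R y"
      using \<open>q \<in> closed_segment x y\<close> by (auto simp: in_segment)
    obtain r' where r': "0 \<le> r'" "q' = (1 - r') *\<^sub>R x + r' *\<^sub>R y"
      using \<open>q' \<in> closed_segment x y\<close> by (auto simp: in_segment)
    have "x - q = r *\<^sub>R (x - y)" "x - q' = r' *\<^sub>R (x - y)"
      by (simp_all add: r r' algebra_simps)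
    then have "r * dist x y = r' * dist x y"
      using \<open>dist x q = dist x q'\<close> r(1) r'(1) by (simp add: dist_norm)
    then have "x = y \<or> r = r'" by simp
    then show ?thesis unfolding r(2) r'(2) by (auto simp flip: scaleR_add_left)
  qed
  show "S = closed_segment x y"
  proof
    show "S \<subseteq> closed_segment x y" using S seg by auto
    show "closed_segment x y \<subseteq> S"
    proof
      fix q assume q: "q \<in> closed_segment x y"
      then have "dist x q \<in> {0..dist x y}"
        by (simp add: between_mem_segment[symmetric] between)
      then have "q = g (dist x q)"
        using unique[OF q seg] gx by simp
      with \<open>dist x q \<in> _\<close> show "q \<in> S" unfolding S by (rule image_eqI[rotated])
    qed
  qed
next
  assume S: "S = closed_segment x y"
  define g where "g s = x + (s / dist x y) *\<^sub>R (y - x)" for s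
  show "geodesic_from_to x y S"
    unfolding geodesic_from_to_def
  proof (intro exI[of _ g] conjI ballI)
    show "g 0 = x" by (simp add: g_def)
    show "g (dist x y) = y" by (cases "x = y") (simp_all add: g_def)
    show "dist (g s) (g t) = \<bar>s - t\<bar>" if st: "s \<in> {0..dist x y}" "t \<in> {0..dist x y}" for s t
    proof (cases "x = y")
      case False
      have "g s - g t = ((s - t) / dist x y) *\<^sub>R (y - x)"
        by (simp add: g_def algebra_simps diff_divide_distrib)
      then have "dist (g s) (g t) = \<bar>s - t\<bar> / dist x y * norm (y - x)"
        by (simp add: dist_norm)
      then show ?thesis using False by (simp add: dist_norm norm_minus_commute)
    qed (use st in simp)
    show "S = g ` {0..dist x y}"
    proof (cases "x = y")
      case False
      have "q \<in> g ` {0..dist x y}" if "q \<in> closed_segment x y" for q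
      proof -
        obtain r where "0 \<le> r" "r \<le> 1" "q = (1 - r) *\<^sub>R x + r *\<^sub>R y"
          using \<open>q \<in> closed_segment x y\<close> by (auto simp: in_segment)
        then show ?thesis using False
          by (intro image_eqI[of _ _ "r * dist x y"])
             (auto simp: g_def algebra_simps mult_left_le_one_le)
      qed
      moreover have "g s \<in> closed_segment x y" if "s \<in> {0..dist x y}" for s
        using that False unfolding in_segment
        by (intro exI[of _ "s / dist x y"]) (auto simp: g_def algebra_simps)
      ultimately show ?thesis using S by auto
    qed (use S in \<open>simp add: g_def\<close>)
  qed
qed

lemma triangle_delta_le:
  fixes x y z :: "'a::euclidean_space"
  assumes c: "c\<^sup>2 = 1 - c" "0 < c" and K: "K\<^sup>2 = c ^ 5" "0 \<le> K"
    and tri: "geodesic_triangle x y z l1 l2 l3"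
  shows "triangle_delta l1 l2 l3 \<le> ereal (K / 2 * triangle_perimeter x y z)"
proof -
  have l: "l1 = closed_segment x y" "l2 = closed_segment y z" "l3 = closed_segment z x"
    using tri by (simp_all add: geodesic_triangle_def geodesic_from_to_iff_closed_segment)
  note bound = infdist_side_le[OF c K]
  have "rips_condition l1 l2 l3 (K / 2 * triangle_perimeter x y z)"
    unfolding rips_condition_def l triangle_perimeter_def
    using bound[of _ x y z] bound[of _ y z x] bound[of _ z x y]
    by (simp add: Un_commute add_ac)
  then show ?thesis unfolding triangle_delta_def by (intro INF_lower) simp
qed

section \<open>The extremal triangle\<close>

text \<open>The unit vector normal to the leg from \<open>s e\<close> to \<open>v f\<close> shows that the leg has distance
  \<open>s v / L\<close> from the midpoint \<open>0\<close> of the base; negating \<open>s\<close> gives the other leg.\<close>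

lemma isosceles_midpoint_dist:
  fixes e f :: "'a::real_inner"
  assumes ef: "norm e = 1" "norm f = 1" "e \<bullet> f = 0"
    and L: "0 < L" "s\<^sup>2 + v\<^sup>2 = L\<^sup>2"
    and q: "q \<in> closed_segment (s *\<^sub>R e) (v *\<^sub>R f)"
  shows "s * v / L \<le> norm q"
proof -
  have inner: "e \<bullet> e = 1" "f \<bullet> f = 1" "f \<bullet> e = 0"
    using ef by (simp_all add: dot_square_norm inner_commute)
  obtain r where q: "q = (1 - r) *\<^sub>R (s *\<^sub>R e) + r *\<^sub>R (v *\<^sub>R f)"
    using q by (auto simp: in_segment)
  define m where "m = v *\<^sub>R e + s *\<^sub>R f"
  have "(norm m)\<^sup>2 = L\<^sup>2"
    using norm_orthogonal_sum[of e "s *\<^sub>R f" v] ef L unfolding m_def by simp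
  then have m: "norm m = L" using L by (simp add: power2_eq_iff_nonneg)
  have "s * v = q \<bullet> m"
    unfolding q m_def using inner ef(3) by (simp add: inner_add_left inner_add_right algebra_simps)
  also have "\<dots> \<le> norm q * L" using norm_cauchy_schwarz[of q m] m by simp
  finally show ?thesis using L by (simp add: divide_le_eq)
qed

lemma ex_extremal_triangle:
  fixes e f :: "'a::euclidean_space"
  assumes ef: "norm e = 1" "norm f = 1" "e \<bullet> f = 0"
    and c: "c\<^sup>2 = 1 - c" "0 < c" and K: "K\<^sup>2 = c ^ 5" "0 \<le> K" and t: "0 < t"
  shows "\<exists>(x::'a) y z l1 l2 l3. geodesic_triangle x y z l1 l2 l3 \<and>
           triangle_perimeter x y z = t \<and> ereal (K / 2 * t) \<le> triangle_delta l1 l2 l3"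
proof -
  \<comment> \<open>half the base, the length of a leg, and the height; \<open>1 / (1 + c) = c\<close>\<close>
  define s where "s = c\<^sup>2 * t / 2"
  define L where "L = c * t / 2"
  define v where "v = sqrt c * L"
  have L: "0 < L" using c t by (simp add: L_def)
  have sL: "s = c * L" by (simp add: s_def L_def power2_eq_square)
  have pyth: "s\<^sup>2 + v\<^sup>2 = L\<^sup>2"
  proof -
    have "s\<^sup>2 + v\<^sup>2 = (c\<^sup>2 + c) * L\<^sup>2"
      using c(2) by (simp add: sL v_def power_mult_distrib algebra_simps)
    then show ?thesis using c(1) by simp
  qed
  have h: "s * v / L = K / 2 * t"
  proof -
    have "K = c\<^sup>2 * sqrt c"
    proof (rule power2_eq_imp_eq)
      show "K\<^sup>2 = (c\<^sup>2 * sqrt c)\<^sup>2"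
        using c K by (simp add: power_mult_distrib power_numeral_reduce)
    qed (use c(2) K(2) in simp_all)
    then show ?thesis using L by (simp add: v_def s_def)
  qed
  define x where "x = (- s) *\<^sub>R e"
  define y where "y = s *\<^sub>R e"
  define z where "z = v *\<^sub>R f"
  define l1 where "l1 = closed_segment x y"
  define l2 where "l2 = closed_segment y z"
  define l3 where "l3 = closed_segment z x"
  have tri: "geodesic_triangle x y z l1 l2 l3"
    by (simp add: geodesic_triangle_def geodesic_from_to_iff_closed_segment l1_def l2_def l3_def)
  have leg: "norm (r *\<^sub>R e + z) = L" if "r\<^sup>2 = s\<^sup>2" for r
  proof -
    have "(norm (r *\<^sub>R e + z))\<^sup>2 = L\<^sup>2"
      using norm_orthogonal_sum[of e z r] ef pyth that by (simp add: z_def)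
    then show ?thesis using L by (simp add: power2_eq_iff_nonneg)
  qed
  have "dist x y = 2 * s"
  proof -
    have "y - x = (2 * s) *\<^sub>R e" by (simp add: x_def y_def flip: scaleR_add_left)
    moreover have "0 \<le> s" using c L by (simp add: sL)
    ultimately show ?thesis using ef by (subst dist_commute) (simp add: dist_norm)
  qed
  moreover have "dist y z = L"
    using leg[of "- s"] by (subst dist_commute) (simp add: dist_norm y_def add.commute)
  moreover have "dist z x = L"
    using leg[of s] by (simp add: dist_norm x_def add.commute)
  ultimately have "triangle_perimeter x y z = (c\<^sup>2 + c) * t"
    by (simp add: triangle_perimeter_def s_def L_def algebra_simps)
  then have per: "triangle_perimeter x y z = t" using c(1) by simp
  have "0 \<in> l1"
    unfolding l1_def x_def y_def in_segment
    by (intro exI[of _ "1/2"]) simp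
  have far: "K / 2 * t \<le> dist 0 q" if "q \<in> l2 \<union> l3" for q
    using that
  proof
    assume "q \<in> l2"
    then show ?thesis
      using isosceles_midpoint_dist[OF ef L pyth] h by (simp add: l2_def y_def z_def)
  next
    assume "q \<in> l3"
    then have "q \<in> closed_segment (s *\<^sub>R (- e)) (v *\<^sub>R f)"
      by (simp add: l3_def x_def z_def closed_segment_commute)
    then show ?thesis
      using isosceles_midpoint_dist[OF _ ef(2) _ L pyth, of "- e" q] ef h by simp
  qed
  have "y \<in> l2 \<union> l3" by (simp add: l2_def)
  then have "l2 \<union> l3 \<noteq> {}" by blast
  then have "K / 2 * t \<le> infdist 0 (l2 \<union> l3)"
    by (simp only: infdist_def if_False) (rule cINF_greatest[OF _ far])
  then have "K / 2 * t \<le> \<delta>" if "rips_condition l1 l2 l3 \<delta>" for \<delta>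
    using that \<open>0 \<in> l1\<close> unfolding rips_condition_def by force
  then have "ereal (K / 2 * t) \<le> triangle_delta l1 l2 l3"
    unfolding triangle_delta_def by (intro INF_greatest) simp
  with tri per show ?thesis by blast
qed

theorem proposition6:
  fixes t :: real
  assumes "t > 0"
  shows "rips_Omega TYPE(real ^ 2) t = ereal (1 / 2 * ((sqrt 5 - 1) / 2) powr (5 / 2) * t)"
proof -
  define c :: real where "c = (sqrt 5 - 1) / 2"
  define K where "K = c powr (5 / 2)"
  have c: "c\<^sup>2 = 1 - c" "0 < c"
    using golden_square golden_pos by (simp_all add: c_def)
  have K: "K\<^sup>2 = c ^ 5" "0 \<le> K"
    using golden_powr by (simp_all add: c_def K_def)
  have "rips_Omega TYPE(real ^ 2) t = ereal (K / 2 * t)"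
    unfolding rips_Omega_def
  proof (rule antisym)
    show "Sup {triangle_delta l1 l2 l3 | (x::real^2) y z l1 l2 l3.
        geodesic_triangle x y z l1 l2 l3 \<and> triangle_perimeter x y z \<le> t} \<le> ereal (K / 2 * t)"
    proof (rule Sup_least, clarify)
      fix x y z :: "real^2" and l1 l2 l3
      assume "geodesic_triangle x y z l1 l2 l3" and per: "triangle_perimeter x y z \<le> t"
      then have "triangle_delta l1 l2 l3 \<le> ereal (K / 2 * triangle_perimeter x y z)"
        using triangle_delta_le[OF c K] by blast
      also have "\<dots> \<le> ereal (K / 2 * t)"
        using per K by (simp add: mult_left_mono)
      finally show "triangle_delta l1 l2 l3 \<le> ereal (K / 2 * t)" .
    qed
    have "axis 1 1 \<bullet> (axis 2 1 :: real^2) = 0" by (simp add: inner_axis_axis)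
    then obtain x y z :: "real^2" and l1 l2 l3 where
      tri: "geodesic_triangle x y z l1 l2 l3" and per: "triangle_perimeter x y z = t"
      and le: "ereal (K / 2 * t) \<le> triangle_delta l1 l2 l3"
      using ex_extremal_triangle[OF _ _ _ c K assms, of "axis 1 1 :: real^2" "axis 2 1"]
      by (auto simp: norm_axis_1)
    have "triangle_perimeter x y z \<le> t" using per by simp
    with tri show "ereal (K / 2 * t) \<le> Sup {triangle_delta l1 l2 l3 | (x::real^2) y z l1 l2 l3.
        geodesic_triangle x y z l1 l2 l3 \<and> triangle_perimeter x y z \<le> t}"
      by (intro Sup_upper2[OF _ le] CollectI) blast
  qed
  then show ?thesis by (simp add: K_def c_def)
qed

end
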